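(* Let $m\ge3$ be an integer, let $|0\rangle,\dots,|m\rangle$ be the standard basis of $\mathbb{C}^{m+1}$, and for $0\le i\ne j\le m-1$ put $$B_{ij}=|i\rangle\langle j|+|i+1\rangle\langle j+1|\in\mathcal{L}(\mathbb{C}^{m+1}).$$ Let $T=\mathrm{span}\{B_{ij}:0\le i\ne j\le m-1\}^{\perp}\subseteq\mathcal{L}(\mathbb{C}^{m+1})$, which is a noncommutative graph with $\mathcal{C}_0^{(1)}(T)=0$. Then $T$ cannot cause superactivation: for every $d\ge1$ and every noncommutative graph $S\subseteq\mathcal{L}(\mathbb{C}^d)$ with $\mathcal{C}_0^{(1)}(S)=0$, one has $\mathcal{C}_0^{(1)}(S\otimes T)=0$. In particular, $\mathcal{C}_0(T)=0$ and $$\mathcal{C}_0(\mathbb{C}I_2\otimes T)\ge\log_2 m>1=\mathcal{C}_0(\mathbb{C}I_2)+\mathcal{C}_0(T).$$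
   Context: $\mathcal{L}(\mathbb{C}^n)$ is the space of linear operators ($n\times n$ complex matrices) on $\mathbb{C}^n$, with Hilbert–Schmidt inner product $\langle X,Y\rangle=\mathrm{Tr}(X^\dagger Y)$; $\perp$ (orthogonality and orthogonal complement) refers to this inner product. A noncommutative graph is a complex linear subspace $S\subseteq\mathcal{L}(\mathbb{C}^n)$ with $S=S^\dagger$ (closed under conjugate transpose) and $I\in S$. For a noncommutative graph $S\subseteq\mathcal{L}(\mathbb{C}^n)$, let $\alpha(S)$ be the maximum number $k$ of nonzero vectors $|\psi_1\rangle,\dots,|\psi_k\rangle\in\mathbb{C}^n$ such that $|\psi_s\rangle\langle\psi_t|\perp S$ for all $s\ne t$. The one-shot zero-error classical capacity is $\mathcal{C}_0^{(1)}(S)=\log_2\alpha(S)$, and the (asymptotic) zero-error classical capacity is $\mathcal{C}_0(S)=\lim_{k\to\infty}\frac1k\mathcal{C}_0^{(1)}(S^{\otimes k})$. $S\otimes T$ denotes the span of all $P\otimes Q$ with $P\in S$, $Q\in T$. Superactivation is the phenomenon that two noncommutative graphs both have zero capacity but their tensor product has positive capacity. $I_2$ is the $2\times2$ identity matrix. *)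

theory Defs
  imports Complex_Main "Jordan_Normal_Form.VS_Connect" "Jordan_Normal_Form.Schur_Decomposition"
begin

abbreviation op_space :: "nat \<Rightarrow> (complex, complex mat) module" where
  "op_space n \<equiv> module_mat TYPE(complex) n n"

abbreviation op_span :: "nat \<Rightarrow> complex mat set \<Rightarrow> complex mat set" where
  "op_span n \<equiv> LinearCombinations.module.span class_ring (op_space n)"

definition ketbra :: "complex vec \<Rightarrow> complex vec \<Rightarrow> complex mat" where
  "ketbra u v = mat (dim_vec u) (dim_vec v) (\<lambda>(i, j). u $ i * cnj (v $ j))"

definition mat_trace :: "complex mat \<Rightarrow> complex" where
  "mat_trace A = (\<Sum>i<dim_row A. A $$ (i, i))"

definition hs_inner :: "complex mat \<Rightarrow> complex mat \<Rightarrow> complex" where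
  "hs_inner X Y = mat_trace (mat_adjoint X * Y)"

definition hs_compl :: "nat \<Rightarrow> complex mat set \<Rightarrow> complex mat set" where
  "hs_compl n S = {X \<in> carrier_mat n n. \<forall>Y\<in>S. hs_inner X Y = 0}"

definition noncommutative_graph :: "nat \<Rightarrow> complex mat set \<Rightarrow> bool" where
  "noncommutative_graph n S \<longleftrightarrow>
     VectorSpace.subspace class_ring S (op_space n) \<and> mat_adjoint ` S = S \<and> 1\<^sub>m n \<in> S"

(* The basis vector |a>|b> of the tensor product of C^n and C^p is numbered a * p + b. *)
definition kron :: "complex mat \<Rightarrow> complex mat \<Rightarrow> complex mat" where
  "kron P Q = mat (dim_row P * dim_row Q) (dim_col P * dim_col Q)
     (\<lambda>(i, j). P $$ (i div dim_row Q, j div dim_col Q) * Q $$ (i mod dim_row Q, j mod dim_col Q))"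

definition graph_tensor ::
    "nat \<Rightarrow> complex mat set \<Rightarrow> nat \<Rightarrow> complex mat set \<Rightarrow> complex mat set" where
  "graph_tensor n S p T = op_span (n * p) {kron P Q | P Q. P \<in> S \<and> Q \<in> T}"

(* k-fold tensor power, acting on a space of dimension n ^ k *)
primrec graph_power :: "nat \<Rightarrow> complex mat set \<Rightarrow> nat \<Rightarrow> complex mat set" where
  "graph_power n S 0 = carrier_mat 1 1"
| "graph_power n S (Suc k) = graph_tensor n S (n ^ k) (graph_power n S k)"

(* For a noncommutative graph, orthogonality to the identity makes the vectors pairwise
   orthogonal, so k is at most n and the maximum is over a finite set. *)
definition indep_number :: "nat \<Rightarrow> complex mat set \<Rightarrow> nat" where
  "indep_number n S = Max {k. \<exists>\<psi> :: nat \<Rightarrow> complex vec.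
     (\<forall>s<k. \<psi> s \<in> carrier_vec n \<and> \<psi> s \<noteq> 0\<^sub>v n) \<and>
     (\<forall>s<k. \<forall>t<k. s \<noteq> t \<longrightarrow> ketbra (\<psi> s) (\<psi> t) \<in> hs_compl n S)}"

definition one_shot_capacity :: "nat \<Rightarrow> complex mat set \<Rightarrow> real" where
  "one_shot_capacity n S = log 2 (real (indep_number n S))"

(* For a noncommutative graph with n >= 1 the limit exists: log2 of the independence numbers of
   the tensor powers is superadditive in k and bounded by k * log2 n. *)
definition zero_error_capacity :: "nat \<Rightarrow> complex mat set \<Rightarrow> real" where
  "zero_error_capacity n S =
     lim (\<lambda>k. 1 / real k * one_shot_capacity (n ^ k) (graph_power n S k))"

definition shift_pair :: "nat \<Rightarrow> nat \<Rightarrow> nat \<Rightarrow> complex mat" where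
  "shift_pair m i j =
     ketbra (unit_vec (m + 1) i) (unit_vec (m + 1) j) +
     ketbra (unit_vec (m + 1) (i + 1)) (unit_vec (m + 1) (j + 1))"

definition shift_graph :: "nat \<Rightarrow> complex mat set" where
  "shift_graph m =
     hs_compl (m + 1) (op_span (m + 1) {shift_pair m i j | i j. i < m \<and> j < m \<and> i \<noteq> j})"

definition scalar_graph :: "nat \<Rightarrow> complex mat set" where
  "scalar_graph n = range (\<lambda>c. c \<cdot>\<^sub>m 1\<^sub>m n)"

end

theory Submission
  imports Defs
begin

text \<open>The graph \<open>T = shift_graph m\<close> contains, for every diagonal, the matrix with alternating signs on it,
  because the two entries of a shift pair are adjacent on their diagonal. Writing \<open>\<psi> = \<Sum>\<^sub>a x\<^sub>a \<otimes> |a\<rangle>\<close> and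
  \<open>\<phi> = \<Sum>\<^sub>b y\<^sub>b \<otimes> |b\<rangle>\<close>, orthogonality of \<open>|\<psi>\<rangle>\<langle>\<phi>|\<close> to \<open>S \<otimes> T\<close> makes all alternating diagonal sums of
  \<open>|x\<^sub>a\<rangle>\<langle>y\<^sub>b|\<close> orthogonal to \<open>S\<close>; the diagonal through the largest \<open>a\<close> and the smallest \<open>b\<close> in the supports
  has a single term, and it is an independent pair for \<open>S\<close>. Hence tensoring with \<open>T\<close> creates no
  independent pair, and by induction no power of \<open>T\<close> has one. The lower bound for the qubit graph tensored with
  \<open>T\<close> is already attained by the one-shot capacity; Fekete's lemma makes the regularised limit exist
  and dominate it.\<close>

section \<open>Spans and the Hilbert--Schmidt form\<close>

lemma submodule_matI:
  assumes "N \<subseteq> carrier_mat n n" "0\<^sub>m n n \<in> N"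
    and "\<And>X Y. X \<in> N \<Longrightarrow> Y \<in> N \<Longrightarrow> X + Y \<in> N"
    and "\<And>c X. X \<in> N \<Longrightarrow> c \<cdot>\<^sub>m X \<in> N"
  shows "submodule class_ring N (op_space n)"
proof -
  interpret vectorspace class_ring "op_space n" by (rule matrix_vs)
  show ?thesis
    by (rule submodule.intro) (use assms module_axioms in \<open>auto simp: module_mat_simps\<close>)
qed

text \<open>Induction over a span, which is the smallest submodule containing the generators. It is
  applied with \<open>N\<close> the kernel of a linear functional and with \<open>N\<close> the
  whole matrix space.\<close>

lemma op_span_subset:
  assumes "A \<subseteq> N" "N \<subseteq> carrier_mat n n" "0\<^sub>m n n \<in> N"
    and "\<And>X Y. X \<in> N \<Longrightarrow> Y \<in> N \<Longrightarrow> X + Y \<in> N"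
    and "\<And>c X. X \<in> N \<Longrightarrow> c \<cdot>\<^sub>m X \<in> N"
  shows "op_span n A \<subseteq> N"
proof -
  interpret vectorspace class_ring "op_space n" by (rule matrix_vs)
  show ?thesis by (rule span_is_subset[OF assms(1) submodule_matI[OF assms(2-5)]])
qed

lemma op_span_carrier: "A \<subseteq> carrier_mat n n \<Longrightarrow> op_span n A \<subseteq> carrier_mat n n"
  by (rule op_span_subset) auto

lemma op_span_superset:
  assumes "A \<subseteq> carrier_mat n n"
  shows "A \<subseteq> op_span n A"
proof -
  interpret vectorspace class_ring "op_space n" by (rule matrix_vs)
  show ?thesis by (rule in_own_span) (use assms in \<open>simp add: module_mat_simps\<close>)
qed

lemma mat_adjoint_index:
  "i < dim_col A \<Longrightarrow> j < dim_row A \<Longrightarrow> mat_adjoint A $$ (i, j) = cnj (A $$ (j, i))" for A :: "complex mat"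
  by (simp add: mat_adjoint_def mat_of_rows_def)

lemma mat_adjoint_dim [simp]:
  "dim_row (mat_adjoint A) = dim_col A" "dim_col (mat_adjoint A) = dim_row A" for A :: "complex mat"
  by (simp_all add: mat_adjoint_def)

lemma mat_adjoint_mat_adjoint: "mat_adjoint (mat_adjoint A) = A" for A :: "complex mat"
  by (rule eq_matI) (simp_all add: mat_adjoint_index)

lemma hs_inner_sum:
  assumes "X \<in> carrier_mat n n" "Y \<in> carrier_mat n n"
  shows "hs_inner X Y = (\<Sum>i<n. \<Sum>j<n. cnj (X $$ (i, j)) * Y $$ (i, j))"
proof -
  have "hs_inner X Y = (\<Sum>j<n. \<Sum>i<n. cnj (X $$ (i, j)) * Y $$ (i, j))"
    using assms
    by (auto simp: hs_inner_def mat_trace_def scalar_prod_def mat_adjoint_index lessThan_atLeast0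
        intro!: sum.cong)
  thus ?thesis by (subst (asm) sum.swap)
qed

text \<open>Transposing the index pair only reorders the double sum. For a self-adjoint graph this
  lets the two vectors of a \<open>ketbra\<close> change places.\<close>

lemma hs_inner_adjoint_left:
  assumes "X \<in> carrier_mat n n" "Y \<in> carrier_mat n n"
  shows "hs_inner (mat_adjoint X) Y = cnj (hs_inner X (mat_adjoint Y))"
proof -
  have "mat_adjoint X \<in> carrier_mat n n" "mat_adjoint Y \<in> carrier_mat n n"
    using assms by (auto intro: carrier_matI)
  with assms have "hs_inner (mat_adjoint X) Y = (\<Sum>i<n. \<Sum>j<n. X $$ (j, i) * Y $$ (i, j))"
    "cnj (hs_inner X (mat_adjoint Y)) = (\<Sum>i<n. \<Sum>j<n. X $$ (i, j) * Y $$ (j, i))"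
    by (simp_all add: hs_inner_sum mat_adjoint_index)
  moreover have "(\<Sum>i<n. \<Sum>j<n. X $$ (j, i) * Y $$ (i, j)) = (\<Sum>i<n. \<Sum>j<n. X $$ (i, j) * Y $$ (j, i))"
    by (rule sum.swap)
  ultimately show ?thesis by simp
qed

lemma hs_inner_commute:
  assumes "X \<in> carrier_mat n n" "Y \<in> carrier_mat n n"
  shows "hs_inner Y X = cnj (hs_inner X Y)"
  using assms by (simp add: hs_inner_sum mult.commute)

lemma hs_inner_add_right:
  assumes "X \<in> carrier_mat n n" "Y \<in> carrier_mat n n" "Z \<in> carrier_mat n n"
  shows "hs_inner X (Y + Z) = hs_inner X Y + hs_inner X Z"
  using assms by (simp add: hs_inner_sum[of _ n] ring_distribs sum.distrib)

lemma hs_inner_smult_right: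
  assumes "X \<in> carrier_mat n n" "Y \<in> carrier_mat n n"
  shows "hs_inner X (c \<cdot>\<^sub>m Y) = c * hs_inner X Y"
  using assms by (simp add: hs_inner_sum[of _ n] sum_distrib_left mult_ac)

lemma hs_inner_zero_right: "X \<in> carrier_mat n n \<Longrightarrow> hs_inner X (0\<^sub>m n n) = 0"
  by (simp add: hs_inner_sum[of _ n])

text \<open>For fixed \<open>X\<close> the matrices \<open>Y\<close> with
  \<open>hs_inner X Y = 0\<close> are closed under linear operations, so generators suffice. This
  removes the spans in \<open>shift_graph\<close> and \<open>graph_tensor\<close> from all later
  arguments.\<close>

lemma hs_compl_span:
  assumes "A \<subseteq> carrier_mat n n"
  shows "hs_compl n (op_span n A) = hs_compl n A"
proof (intro equalityI subsetI)
  fix X assume "X \<in> hs_compl n (op_span n A)"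
  thus "X \<in> hs_compl n A" using op_span_superset[OF assms] by (auto simp: hs_compl_def)
next
  fix X assume X: "X \<in> hs_compl n A"
  hence "op_span n A \<subseteq> {Y \<in> carrier_mat n n. hs_inner X Y = 0}"
    using assms by (intro op_span_subset)
      (auto simp: hs_compl_def hs_inner_zero_right hs_inner_add_right hs_inner_smult_right)
  thus "X \<in> hs_compl n (op_span n A)" using X by (auto simp: hs_compl_def)
qed

lemma hs_compl_subspace:
  assumes "A \<subseteq> carrier_mat n n"
  shows "VectorSpace.subspace class_ring (hs_compl n A) (op_space n)"
proof -
  interpret vectorspace class_ring "op_space n" by (rule matrix_vs)
  \<comment> \<open>The form is conjugate-linear on the left and linear on the right; moving
    \<open>X\<close> to the right turns the closure conditions into plain linearity.\<close>
  have "hs_compl n A = {X \<in> carrier_mat n n. \<forall>Y\<in>A. hs_inner Y X = 0}"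
    using assms hs_inner_commute[of _ n] by (fastforce simp: hs_compl_def)
  hence "submodule class_ring (hs_compl n A) (op_space n)"
    using assms by (intro submodule_matI)
      (auto simp: subset_iff hs_inner_zero_right hs_inner_add_right[of _ n] hs_inner_smult_right[of _ n])
  thus ?thesis using vectorspace_axioms by (simp add: VectorSpace.subspace_def)
qed

section \<open>Kronecker products\<close>

lemma kron_carrier:
  "P \<in> carrier_mat n n \<Longrightarrow> Q \<in> carrier_mat p p \<Longrightarrow> kron P Q \<in> carrier_mat (n * p) (n * p)"
  by (simp add: kron_def)

lemma mult_add_less: "a < n \<Longrightarrow> c < p \<Longrightarrow> a * p + c < n * p" for a c n p :: nat
proof -
  assume "a < n" "c < p"
  hence "a * p + c < Suc a * p" by simp
  moreover have "Suc a * p \<le> n * p" using \<open>a < n\<close> by (intro mult_le_mono1) simp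
  ultimately show "a * p + c < n * p" by linarith
qed

lemma div_mod_less:
  fixes i n p :: nat
  assumes "i < n * p"
  shows "i div p < n" "i mod p < p"
proof -
  show "i div p < n" by (rule less_mult_imp_div_less) (rule assms)
  have "p > 0" using assms by (cases p) auto
  thus "i mod p < p" by simp
qed

lemma kron_index:
  assumes "P \<in> carrier_mat n n" "Q \<in> carrier_mat p p" "a < n" "b < n" "c < p" "e < p"
  shows "kron P Q $$ (a * p + c, b * p + e) = P $$ (a, b) * Q $$ (c, e)"
  using assms mult_add_less[of a n c p] mult_add_less[of b n e p] by (simp add: kron_def)

lemma sum_lessThan_times:
  fixes f :: "nat \<Rightarrow> 'a :: comm_monoid_add"
  shows "sum f {..<n * p} = (\<Sum>a<n. \<Sum>c<p. f (a * p + c))"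
proof -
  have "sum f {..<n * p} = (\<Sum>a<n. sum f {a * p..<a * p + p})"
    by (simp add: sum.nat_group)
  also have "\<dots> = (\<Sum>a<n. \<Sum>c<p. f (a * p + c))"
    by (rule sum.cong[OF refl], subst sum.atLeastLessThan_shift_0) (simp add: lessThan_atLeast0)
  finally show ?thesis .
qed

lemma hs_inner_kron:
  assumes "X \<in> carrier_mat (n * p) (n * p)" "P \<in> carrier_mat n n" "Q \<in> carrier_mat p p"
  shows "hs_inner X (kron P Q) = (\<Sum>a<n. \<Sum>b<n. \<Sum>c<p. \<Sum>e<p.
    cnj (X $$ (a * p + c, b * p + e)) * P $$ (a, b) * Q $$ (c, e))"
proof -
  have "hs_inner X (kron P Q) = (\<Sum>a<n. \<Sum>c<p. \<Sum>b<n. \<Sum>e<p.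
    cnj (X $$ (a * p + c, b * p + e)) * P $$ (a, b) * Q $$ (c, e))"
    using assms by (simp add: hs_inner_sum[OF _ kron_carrier] sum_lessThan_times kron_index mult.assoc)
  also have "\<dots> = (\<Sum>a<n. \<Sum>b<n. \<Sum>c<p. \<Sum>e<p.
    cnj (X $$ (a * p + c, b * p + e)) * P $$ (a, b) * Q $$ (c, e))"
    by (rule sum.cong[OF refl], rule sum.swap)
  finally show ?thesis .
qed

lemma hs_inner_kron_kron:
  assumes "X \<in> carrier_mat n n" "Y \<in> carrier_mat p p" "P \<in> carrier_mat n n" "Q \<in> carrier_mat p p"
  shows "hs_inner (kron X Y) (kron P Q) = hs_inner X P * hs_inner Y Q"
proof -
  have "hs_inner (kron X Y) (kron P Q) = (\<Sum>a<n. \<Sum>b<n. \<Sum>c<p. \<Sum>e<p.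
      (cnj (X $$ (a, b)) * P $$ (a, b)) * (cnj (Y $$ (c, e)) * Q $$ (c, e)))"
    using assms by (simp add: hs_inner_kron[OF kron_carrier] kron_index mult_ac)
  also have "\<dots> = hs_inner X P * hs_inner Y Q"
    using assms by (simp add: hs_inner_sum[of _ n] hs_inner_sum[of _ p]
      sum_distrib_left[symmetric] sum_distrib_right[symmetric])
  finally show ?thesis .
qed

text \<open>\<open>Z\<close> is the partial contraction of \<open>X\<close> against \<open>P\<close>
  over the first factor, with \<open>P\<close> conjugated because \<open>hs_inner\<close> conjugates
  its left argument. For fixed \<open>P\<close>, a condition on products becomes a condition on
  \<open>Q\<close> alone.\<close>

lemma hs_inner_kron_contract:
  assumes "X \<in> carrier_mat (n * p) (n * p)" "P \<in> carrier_mat n n"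
  obtains Z where "Z \<in> carrier_mat p p" "\<And>Q. Q \<in> carrier_mat p p \<Longrightarrow> hs_inner X (kron P Q) = hs_inner Z Q"
proof
  define Z where "Z = mat p p (\<lambda>(c, e). \<Sum>a<n. \<Sum>b<n. X $$ (a * p + c, b * p + e) * cnj (P $$ (a, b)))"
  show "Z \<in> carrier_mat p p" by (simp add: Z_def)
  fix Q :: "complex mat" assume Q: "Q \<in> carrier_mat p p"
  have "hs_inner Z Q = (\<Sum>c<p. \<Sum>e<p. \<Sum>a<n. \<Sum>b<n. cnj (X $$ (a * p + c, b * p + e)) * P $$ (a, b) * Q $$ (c, e))"
    using Q by (simp add: hs_inner_sum[of _ p] Z_def sum_distrib_right)
  also have "\<dots> = (\<Sum>c<p. \<Sum>a<n. \<Sum>b<n. \<Sum>e<p. cnj (X $$ (a * p + c, b * p + e)) * P $$ (a, b) * Q $$ (c, e))"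
    by (rule sum.cong[OF refl], rule trans[OF sum.swap], rule sum.cong[OF refl], rule sum.swap)
  also have "\<dots> = (\<Sum>a<n. \<Sum>b<n. \<Sum>c<p. \<Sum>e<p. cnj (X $$ (a * p + c, b * p + e)) * P $$ (a, b) * Q $$ (c, e))"
    by (rule trans[OF sum.swap], rule sum.cong[OF refl], rule sum.swap)
  finally show "hs_inner X (kron P Q) = hs_inner Z Q"
    using assms Q by (simp add: hs_inner_kron)
qed

lemma kron_one_left: "kron (1\<^sub>m 1) Q = Q"
  by (rule eq_matI) (simp_all add: kron_def)

lemma kron_one_one: "kron (1\<^sub>m n) (1\<^sub>m p) = 1\<^sub>m (n * p)"
proof (rule eq_matI)
  fix i j assume "i < dim_row (1\<^sub>m (n * p))" "j < dim_col (1\<^sub>m (n * p))"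
  moreover from this have "i div p < n" "j div p < n" "p > 0"
    by (auto simp: less_mult_imp_div_less intro: Nat.gr0I)
  moreover have "i = j \<longleftrightarrow> i div p = j div p \<and> i mod p = j mod p"
    by (metis div_mod_decomp)
  ultimately show "kron (1\<^sub>m n) (1\<^sub>m p) $$ (i, j) = 1\<^sub>m (n * p) $$ (i, j)"
    by (auto simp: kron_def)
qed (simp_all add: kron_def)

lemma kron_smult: "kron (c \<cdot>\<^sub>m P) (d \<cdot>\<^sub>m Q) = (c * d) \<cdot>\<^sub>m kron P Q"
  by (rule eq_matI) (auto simp: kron_def div_mod_less)

lemma kron_assoc: "kron (kron P Q) R = kron P (kron Q R)"
proof (rule eq_matI)
  fix i j
  assume "i < dim_row (kron P (kron Q R))" "j < dim_col (kron P (kron Q R))"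
  hence i: "i < dim_row P * dim_row Q * dim_row R" "i < dim_row P * (dim_row Q * dim_row R)"
    and j: "j < dim_col P * dim_col Q * dim_col R" "j < dim_col P * (dim_col Q * dim_col R)"
    by (simp_all add: kron_def mult.assoc)
  \<comment> \<open>The three mixed-radix digits of \<open>i\<close> are the same for both
    bracketings.\<close>
  have split: "i div (q * r) = i div r div q" "i mod (q * r) div r = i div r mod q"
    "i mod (q * r) mod r = i mod r" if "i < p * (q * r)" for i p q r :: nat
  proof -
    from that have "r > 0" by (cases r) auto
    show "i div (q * r) = i div r div q" by (metis div_mult2_eq mult.commute)
    have "i mod (q * r) = r * (i div r mod q) + i mod r" by (metis mod_mult2_eq mult.commute)
    with \<open>r > 0\<close> show "i mod (q * r) div r = i div r mod q" "i mod (q * r) mod r = i mod r" by simp_all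
  qed
  show "kron (kron P Q) R $$ (i, j) = kron P (kron Q R) $$ (i, j)"
    using i j div_mod_less[OF i(1)] div_mod_less[OF j(1)] div_mod_less[OF i(2)] div_mod_less[OF j(2)]
    by (simp add: kron_def split[OF i(2)] split[OF j(2)] mult.assoc)
qed (simp_all add: kron_def mult.assoc)

text \<open>The index order is that of \<open>kron\<close>, so the ket-bra of two product vectors
  factors (\<open>ketbra_kron_vec\<close>).\<close>

definition kron_vec :: "complex vec \<Rightarrow> complex vec \<Rightarrow> complex vec" where
  "kron_vec u v = vec (dim_vec u * dim_vec v) (\<lambda>i. u $ (i div dim_vec v) * v $ (i mod dim_vec v))"

lemma ketbra_carrier: "x \<in> carrier_vec n \<Longrightarrow> y \<in> carrier_vec n \<Longrightarrow> ketbra x y \<in> carrier_mat n n"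
  by (simp add: ketbra_def)

lemma ketbra_kron_vec:
  assumes "dim_vec u = dim_vec u'" "dim_vec v = dim_vec v'"
  shows "ketbra (kron_vec u v) (kron_vec u' v') = kron (ketbra u u') (ketbra v v')"
  using assms
  by (intro eq_matI)
    (auto simp: kron_def ketbra_def kron_vec_def div_mod_less)

lemma kron_vec_carrier: "u \<in> carrier_vec n \<Longrightarrow> v \<in> carrier_vec p \<Longrightarrow> kron_vec u v \<in> carrier_vec (n * p)"
  by (auto simp: kron_vec_def intro!: carrier_vecI)

lemma kron_vec_nonzero:
  assumes "u \<in> carrier_vec n" "v \<in> carrier_vec p" "u \<noteq> 0\<^sub>v n" "v \<noteq> 0\<^sub>v p"
  shows "kron_vec u v \<noteq> 0\<^sub>v (n * p)"
proof -
  from assms obtain a c where ac: "a < n" "u $ a \<noteq> 0" "c < p" "v $ c \<noteq> 0"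
    by (metis carrier_vecD eq_vecI index_zero_vec)
  hence "kron_vec u v $ (a * p + c) = u $ a * v $ c"
    using assms mult_add_less[of a n c p] by (simp add: kron_vec_def)
  with ac show ?thesis using mult_add_less[of a n c p] by (auto simp: index_zero_vec)
qed

section \<open>Graphs without independent pairs\<close>

lemma hs_inner_ketbra:
  assumes "x \<in> carrier_vec n" "y \<in> carrier_vec n" "P \<in> carrier_mat n n"
  shows "hs_inner (ketbra x y) P = (\<Sum>i<n. \<Sum>j<n. cnj (x $ i) * y $ j * P $$ (i, j))"
  using assms by (simp add: hs_inner_sum[OF ketbra_carrier]) (simp add: ketbra_def)

text \<open>For a noncommutative graph with \<open>d \<ge> 1\<close> this amounts to zero one-shot
  capacity, by \<open>connected_graphI\<close> and \<open>one_shot_capacity_connected\<close>. It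
  speaks of a single ket-bra, a form that passes easily through tensor products.\<close>

definition connected_graph :: "nat \<Rightarrow> complex mat set \<Rightarrow> bool" where
  "connected_graph d S \<longleftrightarrow> (\<forall>x\<in>carrier_vec d. \<forall>y\<in>carrier_vec d.
     ketbra x y \<in> hs_compl d S \<longrightarrow> x = 0\<^sub>v d \<or> y = 0\<^sub>v d)"

lemma hs_compl_graph_tensor:
  assumes "S \<subseteq> carrier_mat n n" "T \<subseteq> carrier_mat p p"
  shows "hs_compl (n * p) (graph_tensor n S p T) =
    {X \<in> carrier_mat (n * p) (n * p). \<forall>P\<in>S. \<forall>Q\<in>T. hs_inner X (kron P Q) = 0}"
proof -
  have "{kron P Q | P Q. P \<in> S \<and> Q \<in> T} \<subseteq> carrier_mat (n * p) (n * p)"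
    using assms kron_carrier by blast
  thus ?thesis by (auto simp: graph_tensor_def hs_compl_span) (auto simp: hs_compl_def)
qed

lemma graph_tensor_carrier:
  assumes "S \<subseteq> carrier_mat n n" "T \<subseteq> carrier_mat p p"
  shows "graph_tensor n S p T \<subseteq> carrier_mat (n * p) (n * p)"
  unfolding graph_tensor_def using assms kron_carrier by (intro op_span_carrier) blast

lemma kron_in_graph_tensor:
  assumes "S \<subseteq> carrier_mat n n" "T \<subseteq> carrier_mat p p" "P \<in> S" "Q \<in> T"
  shows "kron P Q \<in> graph_tensor n S p T"
proof -
  have "{kron P Q | P Q. P \<in> S \<and> Q \<in> T} \<subseteq> carrier_mat (n * p) (n * p)"
    using assms kron_carrier by blast
  from op_span_superset[OF this] show ?thesis using assms(3,4) by (auto simp: graph_tensor_def)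
qed

section \<open>The shift graph as a system of linear equations between matrix entries\<close>

lemma shift_pair_carrier: "shift_pair m i j \<in> carrier_mat (m + 1) (m + 1)"
  by (simp add: shift_pair_def ketbra_def)

lemma shift_pair_index:
  assumes "i < m" "j < m" "a < m + 1" "b < m + 1"
  shows "shift_pair m i j $$ (a, b) = of_bool (a = i \<and> b = j) + of_bool (a = i + 1 \<and> b = j + 1)"
  using assms by (simp add: shift_pair_def ketbra_def unit_vec_def)

lemma hs_inner_shift_pair:
  assumes "X \<in> carrier_mat (m + 1) (m + 1)" "i < m" "j < m"
  shows "hs_inner X (shift_pair m i j) = cnj (X $$ (i, j)) + cnj (X $$ (i + 1, j + 1))"
proof -
  have "hs_inner X (shift_pair m i j) = (\<Sum>a<m + 1. \<Sum>b<m + 1.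
      (if a = i then if b = j then cnj (X $$ (a, b)) else 0 else 0) +
      (if a = i + 1 then if b = j + 1 then cnj (X $$ (a, b)) else 0 else 0))"
    unfolding hs_inner_sum[OF assms(1) shift_pair_carrier]
    by (intro sum.cong refl) (use assms in \<open>simp add: shift_pair_index\<close>)
  also have "\<dots> = (\<Sum>a<m + 1. (if a = i then cnj (X $$ (i, j)) else 0) +
      (if a = i + 1 then cnj (X $$ (i + 1, j + 1)) else 0))"
    by (intro sum.cong refl) (use assms in \<open>simp add: sum.distrib\<close>)
  also have "\<dots> = cnj (X $$ (i, j)) + cnj (X $$ (i + 1, j + 1))"
    using assms by (simp add: sum.distrib)
  finally show ?thesis .
qed

text \<open>Every generator contributes one equation: neighbours on a diagonal other than the main
  one are negatives of each other. The condition \<open>i \<noteq> j\<close> leaves the main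
  diagonal free, which puts the identity into the graph.\<close>

lemma shift_graph_eq:
  "shift_graph m = {X \<in> carrier_mat (m + 1) (m + 1).
     \<forall>i<m. \<forall>j<m. i \<noteq> j \<longrightarrow> X $$ (i, j) + X $$ (i + 1, j + 1) = 0}"
proof -
  let ?B = "{shift_pair m i j | i j. i < m \<and> j < m \<and> i \<noteq> j}"
  have B: "?B \<subseteq> carrier_mat (m + 1) (m + 1)" using shift_pair_carrier by blast
  have cnj_iff: "cnj u + cnj v = 0 \<longleftrightarrow> u + v = 0" for u v
    by (metis complex_cnj_add complex_cnj_zero_iff)
  have "shift_graph m = {X \<in> carrier_mat (m + 1) (m + 1).
      \<forall>i<m. \<forall>j<m. i \<noteq> j \<longrightarrow> hs_inner X (shift_pair m i j) = 0}"
    unfolding shift_graph_def hs_compl_span[OF B] by (auto simp: hs_compl_def)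
  thus ?thesis by (auto simp: hs_inner_shift_pair cnj_iff)
qed

lemma shift_graph_carrier: "shift_graph m \<subseteq> carrier_mat (m + 1) (m + 1)"
  by (auto simp: shift_graph_eq)

lemma one_in_shift_graph: "1\<^sub>m (m + 1) \<in> shift_graph m"
  by (simp add: shift_graph_eq)

lemma noncommutative_graph_shift_graph: "noncommutative_graph (m + 1) (shift_graph m)"
proof -
  let ?B = "{shift_pair m i j | i j. i < m \<and> j < m \<and> i \<noteq> j}"
  have B: "?B \<subseteq> carrier_mat (m + 1) (m + 1)" using shift_pair_carrier by blast
  have adj: "mat_adjoint X \<in> shift_graph m" if "X \<in> shift_graph m" for X
  proof -
    have "cnj u + cnj v = 0 \<longleftrightarrow> u + v = 0" for u v
      by (metis complex_cnj_add complex_cnj_zero_iff)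
    \<comment> \<open>The adjoint conjugates the equations and exchanges the one for
      \<open>(i, j)\<close> with the one for \<open>(j, i)\<close>.\<close>
    with that show ?thesis
      by (auto simp: shift_graph_eq mat_adjoint_index intro!: carrier_matI)
  qed
  \<comment> \<open>The adjoint is an involution, so the inclusion is already an equality.\<close>
  hence "mat_adjoint ` shift_graph m = shift_graph m"
    by (metis (no_types, lifting) image_eqI image_subsetI mat_adjoint_mat_adjoint subsetI subset_antisym)
  moreover have "VectorSpace.subspace class_ring (shift_graph m) (op_space (m + 1))"
    unfolding shift_graph_def hs_compl_span[OF B] by (rule hs_compl_subspace[OF B])
  ultimately show ?thesis using one_in_shift_graph by (simp add: noncommutative_graph_def)
qed

text \<open>Here \<open>k\<close> is row minus column. The sign depends on the row, so neighbours
  cancel; what is used later is that the support is exactly one diagonal.\<close>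

definition diagonal_sign :: "nat \<Rightarrow> int \<Rightarrow> complex mat" where
  "diagonal_sign m k =
     mat (m + 1) (m + 1) (\<lambda>(a, b). if int a - int b = k then (- 1) ^ a else 0)"

lemma diagonal_sign_in_shift_graph: "diagonal_sign m k \<in> shift_graph m"
  by (auto simp: shift_graph_eq diagonal_sign_def)

text \<open>The core of the argument, with the two vectors already cut into components along the
  shift factor. In this form it serves both orders of the tensor factors.\<close>

lemma connected_graph_families:
  assumes conn: "connected_graph d S"
    and x: "\<And>a. x a \<in> carrier_vec d" and y: "\<And>b. y b \<in> carrier_vec d"
    and zero: "\<And>P A. P \<in> S \<Longrightarrow> A \<in> shift_graph m \<Longrightarrow>
      (\<Sum>a<m + 1. \<Sum>b<m + 1. A $$ (a, b) * hs_inner (ketbra (x a) (y b)) P) = 0"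
    and S: "S \<subseteq> carrier_mat d d"
  shows "(\<forall>a<m + 1. x a = 0\<^sub>v d) \<or> (\<forall>b<m + 1. y b = 0\<^sub>v d)"
proof (rule ccontr)
  assume neg: "\<not> ?thesis"
  \<comment> \<open>The extreme choice: if \<open>a' \<le> a\<close> and \<open>b' \<ge> b\<close>,
    then \<open>a' - b' = a - b\<close> forces \<open>a' = a\<close> and
    \<open>b' = b\<close>.\<close>
  define a where "a = Max {a. a < m + 1 \<and> x a \<noteq> 0\<^sub>v d}"
  define b where "b = Min {b. b < m + 1 \<and> y b \<noteq> 0\<^sub>v d}"
  have a: "a < m + 1" "x a \<noteq> 0\<^sub>v d"
    using Max_in[of "{a. a < m + 1 \<and> x a \<noteq> 0\<^sub>v d}"] neg by (auto simp: a_def)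
  have b: "b < m + 1" "y b \<noteq> 0\<^sub>v d"
    using Min_in[of "{b. b < m + 1 \<and> y b \<noteq> 0\<^sub>v d}"] neg by (auto simp: b_def)
  have a_max: "x a' = 0\<^sub>v d" if "a < a'" "a' < m + 1" for a'
    using that Max_ge[of "{a. a < m + 1 \<and> x a \<noteq> 0\<^sub>v d}" a', folded a_def] by fastforce
  have b_min: "y b' = 0\<^sub>v d" if "b' < b" "b' < m + 1" for b'
    using that Min_le[of "{b. b < m + 1 \<and> y b \<noteq> 0\<^sub>v d}" b', folded b_def] by fastforce
  let ?A = "diagonal_sign m (int a - int b)"
  have "hs_inner (ketbra (x a) (y b)) P = 0" if P: "P \<in> S" for P
  proof -
    have Pc: "P \<in> carrier_mat d d" using P S by blast
    \<comment> \<open>The nested conditionals make the two sums collapse one after the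
      other.\<close>
    have term_eq: "?A $$ (a', b') * hs_inner (ketbra (x a') (y b')) P =
        (if a' = a then if b' = b then (- 1) ^ a * hs_inner (ketbra (x a) (y b)) P else 0 else 0)"
      if "a' < m + 1" "b' < m + 1" for a' b'
    proof (cases "a' = a \<and> b' = b")
      case True
      thus ?thesis using a b by (simp add: diagonal_sign_def)
    next
      case False
      \<comment> \<open>Along one diagonal both indices move together: another pair either exceeds
        \<open>a\<close> or falls below \<open>b\<close>, and there a component vanishes.\<close>
      have "int a' - int b' \<noteq> int a - int b \<or> a < a' \<or> b' < b"
        using False by linarith
      hence "int a' - int b' \<noteq> int a - int b \<or> x a' = 0\<^sub>v d \<or> y b' = 0\<^sub>v d"
        using a_max b_min that by blast
      moreover have "hs_inner (ketbra (x a') (y b')) P = 0" if "x a' = 0\<^sub>v d \<or> y b' = 0\<^sub>v d"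
        unfolding hs_inner_ketbra[OF x y Pc] using that by (intro sum.neutral ballI) auto
      ultimately show ?thesis using False that by (auto simp: diagonal_sign_def)
    qed
    have "0 = (\<Sum>a'<m + 1. \<Sum>b'<m + 1. ?A $$ (a', b') * hs_inner (ketbra (x a') (y b')) P)"
      using zero[OF P diagonal_sign_in_shift_graph] by simp
    also have "\<dots> = (\<Sum>a'<m + 1. \<Sum>b'<m + 1.
        (if a' = a then if b' = b then (- 1) ^ a * hs_inner (ketbra (x a) (y b)) P else 0 else 0))"
      by (intro sum.cong refl term_eq) auto
    also have "\<dots> = (\<Sum>a'<m + 1. if a' = a then (- 1) ^ a * hs_inner (ketbra (x a) (y b)) P else 0)"
      by (intro sum.cong refl) (use b in simp)
    also have "\<dots> = (- 1) ^ a * hs_inner (ketbra (x a) (y b)) P"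
      using a by simp
    finally show ?thesis by simp
  qed
  hence "ketbra (x a) (y b) \<in> hs_compl d S"
    using ketbra_carrier[OF x y] by (simp add: hs_compl_def)
  thus False using conn a b x y by (auto simp: connected_graph_def)
qed

text \<open>The shift factor stands on the left, as in the recursion of \<open>graph_power\<close>;
  this is the induction step for the powers of the shift graph.\<close>

lemma connected_shift_tensor:
  assumes "connected_graph d S" and S: "S \<subseteq> carrier_mat d d"
  shows "connected_graph ((m + 1) * d) (graph_tensor (m + 1) (shift_graph m) d S)"
  unfolding connected_graph_def
proof (intro ballI impI)
  fix \<psi> \<phi> :: "complex vec"
  assume \<psi>: "\<psi> \<in> carrier_vec ((m + 1) * d)" and \<phi>: "\<phi> \<in> carrier_vec ((m + 1) * d)"
    and orth: "ketbra \<psi> \<phi> \<in> hs_compl ((m + 1) * d) (graph_tensor (m + 1) (shift_graph m) d S)"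
  \<comment> \<open>The component at basis vector \<open>a\<close> of the left factor is a
    contiguous block of length \<open>d\<close>.\<close>
  define slice where "slice v a = vec d (\<lambda>r. v $ (a * d + r))" for v :: "complex vec" and a
  have slice: "slice v a \<in> carrier_vec d" for v a by (simp add: slice_def)
  have "(\<Sum>a<m + 1. \<Sum>b<m + 1. A $$ (a, b) * hs_inner (ketbra (slice \<psi> a) (slice \<phi> b)) P) = 0"
    if "P \<in> S" "A \<in> shift_graph m" for P A
  proof -
    have c: "P \<in> carrier_mat d d" "A \<in> carrier_mat (m + 1) (m + 1)"
      using that S shift_graph_carrier by auto
    have "0 = hs_inner (ketbra \<psi> \<phi>) (kron A P)"
      using orth that unfolding hs_compl_graph_tensor[OF shift_graph_carrier S] by auto
    also have "\<dots> = (\<Sum>a<m + 1. \<Sum>b<m + 1. \<Sum>r<d. \<Sum>s<d.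
        A $$ (a, b) * (cnj (\<psi> $ (a * d + r)) * \<phi> $ (b * d + s) * P $$ (r, s)))"
      unfolding hs_inner_kron[OF ketbra_carrier[OF \<psi> \<phi>] c(2,1)]
      using \<psi> \<phi> mult_add_less by (intro sum.cong refl) (simp add: ketbra_def del: mult_Suc)
    also have "\<dots> = (\<Sum>a<m + 1. \<Sum>b<m + 1. A $$ (a, b) * hs_inner (ketbra (slice \<psi> a) (slice \<phi> b)) P)"
      using c by (simp add: hs_inner_ketbra[OF slice slice] sum_distrib_left) (simp add: slice_def)
    finally show ?thesis by simp
  qed
  hence "(\<forall>a<m + 1. slice \<psi> a = 0\<^sub>v d) \<or> (\<forall>b<m + 1. slice \<phi> b = 0\<^sub>v d)"
    by (intro connected_graph_families[OF assms(1) slice slice _ S]) auto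
  moreover have "v = 0\<^sub>v ((m + 1) * d)"
    if v: "v \<in> carrier_vec ((m + 1) * d)" and zero: "\<forall>a<m + 1. slice v a = 0\<^sub>v d" for v
  proof (rule eq_vecI)
    fix i assume "i < dim_vec (0\<^sub>v ((m + 1) * d) :: complex vec)"
    hence i: "i < (m + 1) * d" by simp
    have "v $ i = slice v (i div d) $ (i mod d)"
      using div_mod_less[OF i] by (simp add: slice_def)
    thus "v $ i = 0\<^sub>v ((m + 1) * d) $ i" using zero i div_mod_less[OF i] by simp
  qed (use v in simp)
  ultimately show "\<psi> = 0\<^sub>v ((m + 1) * d) \<or> \<phi> = 0\<^sub>v ((m + 1) * d)" using \<psi> \<phi> by blast
qed

text \<open>The same argument with the shift factor on the right, the order in which superactivation
  is excluded.\<close>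

lemma connected_tensor_shift:
  assumes "connected_graph d S" and S: "S \<subseteq> carrier_mat d d"
  shows "connected_graph (d * (m + 1)) (graph_tensor d S (m + 1) (shift_graph m))"
  unfolding connected_graph_def
proof (intro ballI impI)
  fix \<psi> \<phi> :: "complex vec"
  assume \<psi>: "\<psi> \<in> carrier_vec (d * (m + 1))" and \<phi>: "\<phi> \<in> carrier_vec (d * (m + 1))"
    and orth: "ketbra \<psi> \<phi> \<in> hs_compl (d * (m + 1)) (graph_tensor d S (m + 1) (shift_graph m))"
  \<comment> \<open>The shift factor is now the fast index, so a component consists of the entries
    whose index is \<open>a\<close> modulo \<open>m + 1\<close>.\<close>
  define slice where "slice v a = vec d (\<lambda>r. v $ (r * (m + 1) + a))" for v :: "complex vec" and a
  have slice: "slice v a \<in> carrier_vec d" for v a by (simp add: slice_def)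
  have "(\<Sum>a<m + 1. \<Sum>b<m + 1. A $$ (a, b) * hs_inner (ketbra (slice \<psi> a) (slice \<phi> b)) P) = 0"
    if "P \<in> S" "A \<in> shift_graph m" for P A
  proof -
    have c: "P \<in> carrier_mat d d" "A \<in> carrier_mat (m + 1) (m + 1)"
      using that S shift_graph_carrier by auto
    \<comment> \<open>Naming the summand lets the sums over the shift indices be moved outside by
      repeated swaps.\<close>
    define F where "F r s a b =
      A $$ (a, b) * (cnj (\<psi> $ (r * (m + 1) + a)) * \<phi> $ (s * (m + 1) + b) * P $$ (r, s))" for r s a b
    have "0 = hs_inner (ketbra \<psi> \<phi>) (kron P A)"
      using orth that unfolding hs_compl_graph_tensor[OF S shift_graph_carrier] by auto
    also have "\<dots> = (\<Sum>r<d. \<Sum>s<d. \<Sum>a<m + 1. \<Sum>b<m + 1. F r s a b)"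
      unfolding hs_inner_kron[OF ketbra_carrier[OF \<psi> \<phi>] c]
      using \<psi> \<phi> mult_add_less by (intro sum.cong refl) (simp add: ketbra_def F_def del: mult_Suc_right)
    also have "\<dots> = (\<Sum>r<d. \<Sum>a<m + 1. \<Sum>b<m + 1. \<Sum>s<d. F r s a b)"
      by (rule sum.cong[OF refl], rule trans[OF sum.swap], rule sum.cong[OF refl], rule sum.swap)
    also have "\<dots> = (\<Sum>a<m + 1. \<Sum>b<m + 1. \<Sum>r<d. \<Sum>s<d. F r s a b)"
      by (rule trans[OF sum.swap], rule sum.cong[OF refl], rule sum.swap)
    also have "\<dots> = (\<Sum>a<m + 1. \<Sum>b<m + 1. A $$ (a, b) * hs_inner (ketbra (slice \<psi> a) (slice \<phi> b)) P)"
      using c by (simp add: hs_inner_ketbra[OF slice slice] sum_distrib_left) (simp add: slice_def F_def)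
    finally show ?thesis by simp
  qed
  hence "(\<forall>a<m + 1. slice \<psi> a = 0\<^sub>v d) \<or> (\<forall>b<m + 1. slice \<phi> b = 0\<^sub>v d)"
    by (intro connected_graph_families[OF assms(1) slice slice _ S]) auto
  moreover have "v = 0\<^sub>v (d * (m + 1))"
    if v: "v \<in> carrier_vec (d * (m + 1))" and zero: "\<forall>a<m + 1. slice v a = 0\<^sub>v d" for v
  proof (rule eq_vecI)
    fix i assume "i < dim_vec (0\<^sub>v (d * (m + 1)) :: complex vec)"
    hence i: "i < d * (m + 1)" by simp
    have "v $ i = slice v (i mod (m + 1)) $ (i div (m + 1))"
      using div_mod_less[OF i] div_mult_mod_eq[of i "m + 1"] by (simp add: slice_def)
    thus "v $ i = 0\<^sub>v (d * (m + 1)) $ i" using zero i div_mod_less[OF i] by simp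
  qed (use v in simp)
  ultimately show "\<psi> = 0\<^sub>v (d * (m + 1)) \<or> \<phi> = 0\<^sub>v (d * (m + 1))" using \<psi> \<phi> by blast
qed

section \<open>Independence numbers\<close>

text \<open>Isolates the predicate under \<open>Max\<close>, which carries information only once the
  set is known to be finite and nonempty.\<close>

definition independent_size :: "nat \<Rightarrow> complex mat set \<Rightarrow> nat \<Rightarrow> bool" where
  "independent_size n S k \<longleftrightarrow> (\<exists>\<psi> :: nat \<Rightarrow> complex vec.
     (\<forall>s<k. \<psi> s \<in> carrier_vec n \<and> \<psi> s \<noteq> 0\<^sub>v n) \<and>
     (\<forall>s<k. \<forall>t<k. s \<noteq> t \<longrightarrow> ketbra (\<psi> s) (\<psi> t) \<in> hs_compl n S))"

lemma indep_number_eq_Max: "indep_number n S = Max {k. independent_size n S k}"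
  by (simp add: indep_number_def independent_size_def)

lemma hs_inner_ketbra_one:
  assumes "x \<in> carrier_vec n" "y \<in> carrier_vec n"
  shows "hs_inner (ketbra x y) (1\<^sub>m n) = (\<Sum>i<n. cnj (x $ i) * y $ i)"
proof -
  have "hs_inner (ketbra x y) (1\<^sub>m n) =
      (\<Sum>i<n. \<Sum>j<n. if i = j then cnj (x $ i) * y $ j else 0)"
    unfolding hs_inner_ketbra[OF assms one_carrier_mat] by (intro sum.cong refl) auto
  thus ?thesis by simp
qed

lemma sum_cnj_mult_nonzero:
  assumes "x \<in> carrier_vec n" "x \<noteq> 0\<^sub>v n"
  shows "(\<Sum>i<n. cnj (x $ i) * x $ i) \<noteq> 0"
proof
  assume "(\<Sum>i<n. cnj (x $ i) * x $ i) = 0"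
  moreover have "(\<Sum>i<n. cnj (x $ i) * x $ i) = of_real (\<Sum>i<n. (cmod (x $ i))\<^sup>2)"
    unfolding of_real_sum by (intro sum.cong refl) (metis complex_norm_square mult.commute)
  ultimately have "(\<Sum>i<n. (cmod (x $ i))\<^sup>2) = 0" by (metis of_real_eq_0_iff)
  hence "\<forall>i<n. x $ i = 0" by (subst (asm) sum_nonneg_eq_0_iff) auto
  hence "x = 0\<^sub>v n" using assms by (intro eq_vecI) auto
  thus False using assms by simp
qed

text \<open>The Gram matrix of \<open>k > n\<close> vectors factors through a square matrix with a zero row.\<close>

lemma independent_size_le_dim:
  assumes "1\<^sub>m n \<in> S" "independent_size n S k"
  shows "k \<le> n"
proof (rule ccontr)
  assume "\<not> k \<le> n"
  hence nk: "n < k" by simp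
  obtain \<psi> :: "nat \<Rightarrow> complex vec"
    where \<psi>: "\<And>s. s < k \<Longrightarrow> \<psi> s \<in> carrier_vec n" "\<And>s. s < k \<Longrightarrow> \<psi> s \<noteq> 0\<^sub>v n"
      and orth: "\<And>s t. s < k \<Longrightarrow> t < k \<Longrightarrow> s \<noteq> t \<Longrightarrow> ketbra (\<psi> s) (\<psi> t) \<in> hs_compl n S"
    using assms(2) by (auto simp: independent_size_def)
  \<comment> \<open>Column \<open>s\<close> of \<open>V\<close> is \<open>\<psi> s\<close> padded
    with zeros, and \<open>W\<close> is the adjoint of \<open>V\<close>, so \<open>W * V\<close> is
    the Gram matrix.\<close>
  define V where "V = mat k k (\<lambda>(i, s). if i < n then \<psi> s $ i else 0)"
  define W where "W = mat k k (\<lambda>(s, i). if i < n then cnj (\<psi> s $ i) else 0)"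
  have c: "V \<in> carrier_mat k k" "W \<in> carrier_mat k k" by (simp_all add: V_def W_def)
  have entry: "(W * V) $$ (s, t) = hs_inner (ketbra (\<psi> s) (\<psi> t)) (1\<^sub>m n)" if "s < k" "t < k" for s t
  proof -
    have "(W * V) $$ (s, t) = (\<Sum>i<k. if i < n then cnj (\<psi> s $ i) * \<psi> t $ i else 0)"
      using that c by (auto simp: scalar_prod_def V_def W_def lessThan_atLeast0 intro!: sum.cong)
    also have "\<dots> = (\<Sum>i<n. cnj (\<psi> s $ i) * \<psi> t $ i)"
      by (rule sum.mono_neutral_cong_right) (use nk in auto)
    also have "\<dots> = hs_inner (ketbra (\<psi> s) (\<psi> t)) (1\<^sub>m n)"
      using that by (intro hs_inner_ketbra_one[symmetric] \<psi>)
    finally show ?thesis .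
  qed
  have off: "(W * V) $$ (s, t) = 0" if "s < k" "t < k" "s \<noteq> t" for s t
    using orth[OF that] assms(1) by (simp add: entry that hs_compl_def)
  have diag: "(W * V) $$ (s, s) \<noteq> 0" if "s < k" for s
    using \<psi>[OF that] by (simp add: entry that hs_inner_ketbra_one sum_cnj_mult_nonzero)
  have WV: "W * V \<in> carrier_mat k k" using c by simp
  \<comment> \<open>Orthogonality to the identity makes the Gram matrix diagonal, with squared norms
    on the diagonal.\<close>
  have "det (W * V) = prod_list (diag_mat (W * V))"
    by (rule det_upper_triangular[OF _ WV]) (use off c in \<open>auto simp: upper_triangular_def\<close>)
  also have "\<dots> \<noteq> 0"
    using diag c by (auto simp: diag_mat_def prod_list_zero_iff)
  finally have "det V \<noteq> 0" using det_mult[OF c(2,1)] by auto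
  moreover have "det V = 0"
  proof -
    \<comment> \<open>Row \<open>n\<close> of \<open>V\<close> exists because \<open>n < k\<close>,
      and it is zero; every term of the Leibniz formula has a factor from it.\<close>
    have zero: "(\<Prod>i = 0..<k. V $$ (i, p i)) = 0" if "p permutes {0..<k}" for p
      using nk permutes_in_image[OF that, of n] by (intro prod_zero) (auto simp: V_def intro!: bexI[of _ n])
    show ?thesis unfolding det_def'[OF c(1)] by (rule sum.neutral) (simp add: zero)
  qed
  ultimately show False by simp
qed

text \<open>Keeps the set under \<open>Max\<close> nonempty even for \<open>n = 0\<close>.\<close>

lemma independent_size_0: "independent_size n S 0"
  by (simp add: independent_size_def)

lemma independent_size_1:
  assumes "n \<ge> 1"
  shows "independent_size n S 1"
  unfolding independent_size_def using assms
  by (intro exI[of _ "\<lambda>_. unit_vec n 0"]) (simp add: unit_vec_nonzero)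

section \<open>Bounds on the capacity of a graph that contains the identity\<close>

context
  fixes n :: nat and S :: "complex mat set"
  assumes one: "1\<^sub>m n \<in> S"
begin

lemma finite_independent_size: "finite {k. independent_size n S k}"
  using independent_size_le_dim[OF one] by (intro finite_subset[OF _ finite_atMost[of n]] subsetI) simp

lemma independent_size_indep_number: "independent_size n S (indep_number n S)"
  unfolding indep_number_eq_Max
  using Max_in[OF finite_independent_size] independent_size_0[of n S] by blast

lemma independent_size_le_indep_number: "independent_size n S k \<Longrightarrow> k \<le> indep_number n S"
  unfolding indep_number_eq_Max by (rule Max_ge[OF finite_independent_size]) simp

lemma indep_number_le_dim: "indep_number n S \<le> n"
  by (rule independent_size_le_dim[OF one independent_size_indep_number])

lemma indep_number_ge_1: "n \<ge> 1 \<Longrightarrow> indep_number n S \<ge> 1"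
  by (rule independent_size_le_indep_number[OF independent_size_1])

lemma one_shot_capacity_nonneg: "n \<ge> 1 \<Longrightarrow> one_shot_capacity n S \<ge> 0"
  unfolding one_shot_capacity_def by (drule indep_number_ge_1) simp

lemma one_shot_capacity_le: "n \<ge> 1 \<Longrightarrow> one_shot_capacity n S \<le> log 2 (real n)"
  using indep_number_le_dim unfolding one_shot_capacity_def by (drule_tac indep_number_ge_1) simp

lemma one_shot_capacity_ge:
  assumes "independent_size n S k" "k \<ge> 1"
  shows "log 2 (real k) \<le> one_shot_capacity n S"
  using independent_size_le_indep_number[OF assms(1)] assms(2) by (simp add: one_shot_capacity_def)

text \<open>Members \<open>0\<close> and \<open>1\<close> of an independent family with at least two
  members would give an excluded ket-bra, so the independence number is 1.\<close>

lemma one_shot_capacity_connected: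
  assumes "n \<ge> 1" "connected_graph n S"
  shows "one_shot_capacity n S = 0"
proof -
  have "indep_number n S < 2"
  proof (rule ccontr)
    assume "\<not> indep_number n S < 2"
    hence less: "0 < indep_number n S" "1 < indep_number n S" by auto
    then obtain x y :: "complex vec" where "x \<in> carrier_vec n" "x \<noteq> 0\<^sub>v n" "y \<in> carrier_vec n" "y \<noteq> 0\<^sub>v n"
      "ketbra x y \<in> hs_compl n S"
      using independent_size_indep_number unfolding independent_size_def
      by (metis zero_neq_one)
    thus False using assms(2) by (auto simp: connected_graph_def)
  qed
  with indep_number_ge_1[OF assms(1)] have "indep_number n S = 1" by simp
  thus ?thesis by (simp add: one_shot_capacity_def)
qed

end

text \<open>A self-adjoint graph orthogonal to \<open>ketbra x y\<close> is also orthogonal to its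
  adjoint \<open>ketbra y x\<close>. Hence one orthogonal ket-bra already gives an independent pair,
  and the capacity would be at least 1.\<close>

lemma connected_graphI:
  assumes S: "noncommutative_graph d S" and "d \<ge> 1" "one_shot_capacity d S = 0"
  shows "connected_graph d S"
  unfolding connected_graph_def
proof (intro ballI impI, rule ccontr)
  fix x y :: "complex vec"
  assume xy: "x \<in> carrier_vec d" "y \<in> carrier_vec d" "\<not> (x = 0\<^sub>v d \<or> y = 0\<^sub>v d)"
    and orth: "ketbra x y \<in> hs_compl d S"
  have one: "1\<^sub>m d \<in> S" and adj: "mat_adjoint ` S = S"
    using S by (auto simp: noncommutative_graph_def)
  have "submodule class_ring S (op_space d)"
    using S by (simp add: noncommutative_graph_def VectorSpace.subspace_def)
  hence Sc: "S \<subseteq> carrier_mat d d"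
    by (auto simp: LinearCombinations.submodule_def module_mat_simps)
  have "ketbra y x = mat_adjoint (ketbra x y)"
    by (intro eq_matI) (auto simp: ketbra_def mat_adjoint_index)
  moreover have "hs_inner (mat_adjoint (ketbra x y)) P = 0" if "P \<in> S" for P
  proof -
    have "P \<in> carrier_mat d d" "mat_adjoint P \<in> S" using that adj Sc by blast+
    thus ?thesis using orth hs_inner_adjoint_left[OF ketbra_carrier[OF xy(1,2)]]
      by (simp add: hs_compl_def)
  qed
  ultimately have "hs_inner (ketbra y x) P = 0" if "P \<in> S" for P using that by simp
  hence "ketbra y x \<in> hs_compl d S" using xy ketbra_carrier by (auto simp: hs_compl_def)
  hence "independent_size d S 2" unfolding independent_size_def using xy orth
    by (intro exI[of _ "\<lambda>s. if s = 0 then x else y"]) (auto simp: less_2_cases_iff)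
  from one_shot_capacity_ge[OF one this] show False using assms(3) by simp
qed

section \<open>Tensor powers\<close>

lemma graph_power_carrier: "S \<subseteq> carrier_mat n n \<Longrightarrow> graph_power n S k \<subseteq> carrier_mat (n ^ k) (n ^ k)"
  by (induction k) (simp_all add: graph_tensor_carrier)

lemma one_in_graph_tensor:
  assumes "S \<subseteq> carrier_mat n n" "T \<subseteq> carrier_mat p p" "1\<^sub>m n \<in> S" "1\<^sub>m p \<in> T"
  shows "1\<^sub>m (n * p) \<in> graph_tensor n S p T"
  using kron_in_graph_tensor[OF assms] by (simp add: kron_one_one)

lemma one_in_graph_power:
  assumes "S \<subseteq> carrier_mat n n" "1\<^sub>m n \<in> S"
  shows "1\<^sub>m (n ^ k) \<in> graph_power n S k"
  by (induction k) (use assms in \<open>simp_all add: one_in_graph_tensor graph_power_carrier\<close>)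

text \<open>Generators of \<open>graph_power\<close> with no span taken at intermediate stages. At
  exponent 0 the identity alone stands for the whole space of \<open>1 \<times> 1\<close>
  matrices.\<close>

primrec elementary_tensors :: "nat \<Rightarrow> complex mat set \<Rightarrow> nat \<Rightarrow> complex mat set" where
  "elementary_tensors n S 0 = {1\<^sub>m 1}"
| "elementary_tensors n S (Suc k) = {kron P Q | P Q. P \<in> S \<and> Q \<in> elementary_tensors n S k}"

lemma elementary_tensors_carrier:
  "S \<subseteq> carrier_mat n n \<Longrightarrow> elementary_tensors n S k \<subseteq> carrier_mat (n ^ k) (n ^ k)"
  by (induction k) (auto intro!: kron_carrier)

text \<open>Induction on the exponent. With the first factor \<open>P\<close> fixed, contracting
  \<open>X\<close> against \<open>P\<close> leaves a matrix on the remaining factors, to which the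
  induction hypothesis applies.\<close>

lemma hs_compl_graph_power:
  assumes S: "S \<subseteq> carrier_mat n n"
  shows "hs_compl (n ^ k) (graph_power n S k) = hs_compl (n ^ k) (elementary_tensors n S k)"
proof (induction k)
  case 0
  \<comment> \<open>In dimension one, orthogonality to the identity already means
    \<open>X = 0\<close>.\<close>
  have "hs_inner X Y = 0" if "X \<in> carrier_mat 1 1" "Y \<in> carrier_mat 1 1" "hs_inner X (1\<^sub>m 1) = 0" for X Y
    using that by (simp add: hs_inner_sum[of _ 1])
  thus ?case by (auto simp: hs_compl_def)
next
  case (Suc k)
  have extend: "hs_inner X (kron P Q) = 0"
    if X: "X \<in> carrier_mat (n * n ^ k) (n * n ^ k)" and P: "P \<in> S" and Q: "Q \<in> graph_power n S k"
      and zero: "\<And>Q. Q \<in> elementary_tensors n S k \<Longrightarrow> hs_inner X (kron P Q) = 0" for X P Q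
  proof -
    obtain Z where Z: "Z \<in> carrier_mat (n ^ k) (n ^ k)"
      "\<And>Q. Q \<in> carrier_mat (n ^ k) (n ^ k) \<Longrightarrow> hs_inner X (kron P Q) = hs_inner Z Q"
      using hs_inner_kron_contract[OF X] P S by blast
    hence "Z \<in> hs_compl (n ^ k) (elementary_tensors n S k)"
      using zero elementary_tensors_carrier[OF S] by (fastforce simp: hs_compl_def)
    hence "hs_inner Z Q = 0" using Suc.IH Q by (auto simp: hs_compl_def)
    moreover have "Q \<in> carrier_mat (n ^ k) (n ^ k)" using Q graph_power_carrier[OF S] by blast
    ultimately show ?thesis using Z by simp
  qed
  have "elementary_tensors n S k \<subseteq> graph_power n S k"
    by (induction k) (use S graph_power_carrier[OF S] in \<open>auto intro!: kron_in_graph_tensor\<close>)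
  hence "(\<forall>P\<in>S. \<forall>Q\<in>graph_power n S k. hs_inner X (kron P Q) = 0) \<longleftrightarrow>
      (\<forall>P\<in>S. \<forall>Q\<in>elementary_tensors n S k. hs_inner X (kron P Q) = 0)"
    if "X \<in> carrier_mat (n * n ^ k) (n * n ^ k)" for X
    using extend[OF that] by (meson subset_iff)
  moreover have "hs_compl (n ^ Suc k) (elementary_tensors n S (Suc k)) =
      {X \<in> carrier_mat (n * n ^ k) (n * n ^ k).
        \<forall>P\<in>S. \<forall>Q\<in>elementary_tensors n S k. hs_inner X (kron P Q) = 0}"
    by (auto simp: hs_compl_def)
  ultimately show ?case
    by (auto simp: hs_compl_graph_tensor[OF S graph_power_carrier[OF S]])
qed

text \<open>Elementary tensors nest to the right; associativity of \<open>kron\<close> moves the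
  brackets to the cut after \<open>a\<close> factors.\<close>

lemma elementary_tensors_add:
  assumes "S \<subseteq> carrier_mat n n"
  shows "R \<in> elementary_tensors n S (a + b) \<Longrightarrow>
    \<exists>P\<in>elementary_tensors n S a. \<exists>Q\<in>elementary_tensors n S b. R = kron P Q"
proof (induction a arbitrary: R)
  case 0
  thus ?case using kron_one_left by auto
next
  case (Suc a)
  then obtain P R' where "P \<in> S" "R' \<in> elementary_tensors n S (a + b)" "R = kron P R'" by auto
  with Suc.IH obtain P' Q where "P' \<in> elementary_tensors n S a" "Q \<in> elementary_tensors n S b"
    "R = kron P (kron P' Q)" by blast
  with \<open>P \<in> S\<close> show ?case by (auto simp: kron_assoc[symmetric])
qed

text \<open>On elementary tensors the inner product factors along the cut, so one vanishing factor
  is enough.\<close>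

lemma kron_in_hs_compl_graph_power:
  assumes S: "S \<subseteq> carrier_mat n n"
    and X: "X \<in> carrier_mat (n ^ a) (n ^ a)" and Y: "Y \<in> carrier_mat (n ^ b) (n ^ b)"
    and orth: "X \<in> hs_compl (n ^ a) (graph_power n S a) \<or> Y \<in> hs_compl (n ^ b) (graph_power n S b)"
  shows "kron X Y \<in> hs_compl (n ^ (a + b)) (graph_power n S (a + b))"
proof -
  have "hs_inner (kron X Y) R = 0" if "R \<in> elementary_tensors n S (a + b)" for R
  proof -
    obtain P Q where PQ: "P \<in> elementary_tensors n S a" "Q \<in> elementary_tensors n S b" "R = kron P Q"
      using elementary_tensors_add[OF S \<open>R \<in> _\<close>] by auto
    hence "hs_inner (kron X Y) R = hs_inner X P * hs_inner Y Q"
      using hs_inner_kron_kron[OF X Y] elementary_tensors_carrier[OF S] by blast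
    thus ?thesis using orth PQ unfolding hs_compl_graph_power[OF S] by (auto simp: hs_compl_def)
  qed
  thus ?thesis unfolding hs_compl_graph_power[OF S]
    using kron_carrier[OF X Y] by (simp add: hs_compl_def power_add)
qed

text \<open>Independent families multiply: distinct product vectors differ in at least one factor,
  and that factor supplies the orthogonality.\<close>

lemma independent_size_graph_power_add:
  assumes S: "S \<subseteq> carrier_mat n n"
    and k: "independent_size (n ^ a) (graph_power n S a) k"
    and l: "independent_size (n ^ b) (graph_power n S b) l"
  shows "independent_size (n ^ (a + b)) (graph_power n S (a + b)) (k * l)"
proof -
  obtain \<psi> :: "nat \<Rightarrow> complex vec"
    where \<psi>: "\<And>s. s < k \<Longrightarrow> \<psi> s \<in> carrier_vec (n ^ a)" "\<And>s. s < k \<Longrightarrow> \<psi> s \<noteq> 0\<^sub>v (n ^ a)"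
      "\<And>s t. s < k \<Longrightarrow> t < k \<Longrightarrow> s \<noteq> t \<Longrightarrow> ketbra (\<psi> s) (\<psi> t) \<in> hs_compl (n ^ a) (graph_power n S a)"
    using k by (auto simp: independent_size_def)
  obtain \<phi> :: "nat \<Rightarrow> complex vec"
    where \<phi>: "\<And>s. s < l \<Longrightarrow> \<phi> s \<in> carrier_vec (n ^ b)" "\<And>s. s < l \<Longrightarrow> \<phi> s \<noteq> 0\<^sub>v (n ^ b)"
      "\<And>s t. s < l \<Longrightarrow> t < l \<Longrightarrow> s \<noteq> t \<Longrightarrow> ketbra (\<phi> s) (\<phi> t) \<in> hs_compl (n ^ b) (graph_power n S b)"
    using l by (auto simp: independent_size_def)
  \<comment> \<open>The index \<open>s\<close> encodes the pair of \<open>s div l\<close> and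
    \<open>s mod l\<close>.\<close>
  define \<chi> where "\<chi> s = kron_vec (\<psi> (s div l)) (\<phi> (s mod l))" for s
  have "\<chi> s \<in> carrier_vec (n ^ (a + b)) \<and> \<chi> s \<noteq> 0\<^sub>v (n ^ (a + b))" if "s < k * l" for s
    using \<psi>(1,2)[OF div_mod_less(1)[OF that]] \<phi>(1,2)[OF div_mod_less(2)[OF that]]
    by (simp add: \<chi>_def power_add kron_vec_carrier kron_vec_nonzero)
  moreover have "ketbra (\<chi> s) (\<chi> t) \<in> hs_compl (n ^ (a + b)) (graph_power n S (a + b))"
    if st: "s < k * l" "t < k * l" "s \<noteq> t" for s t
  proof -
    note less = div_mod_less[OF st(1)] div_mod_less[OF st(2)]
    note c = \<psi>(1)[OF less(1)] \<psi>(1)[OF less(3)] \<phi>(1)[OF less(2)] \<phi>(1)[OF less(4)]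
    have "s div l \<noteq> t div l \<or> s mod l \<noteq> t mod l" using st(3) by (metis div_mod_decomp)
    hence "ketbra (\<psi> (s div l)) (\<psi> (t div l)) \<in> hs_compl (n ^ a) (graph_power n S a) \<or>
      ketbra (\<phi> (s mod l)) (\<phi> (t mod l)) \<in> hs_compl (n ^ b) (graph_power n S b)"
      using \<psi>(3)[OF less(1,3)] \<phi>(3)[OF less(2,4)] by blast
    moreover have "ketbra (\<chi> s) (\<chi> t) =
        kron (ketbra (\<psi> (s div l)) (\<psi> (t div l))) (ketbra (\<phi> (s mod l)) (\<phi> (t mod l)))"
      unfolding \<chi>_def using c by (intro ketbra_kron_vec) auto
    ultimately show ?thesis
      using kron_in_hs_compl_graph_power[OF S ketbra_carrier[OF c(1,2)] ketbra_carrier[OF c(3,4)]]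
      by simp
  qed
  ultimately show ?thesis by (auto simp: independent_size_def)
qed

section \<open>Asymptotic capacities\<close>

text \<open>The limit is the supremum of the quotients, finite by the linear bound and hence at
  least \<open>u 1\<close>.\<close>

lemma fekete_superadditive:
  fixes u :: "nat \<Rightarrow> real"
  assumes super: "\<And>a b. u a + u b \<le> u (a + b)"
    and nonneg: "\<And>a. 0 \<le> u a" and bound: "\<And>a. u a \<le> real a * C"
  obtains L where "(\<lambda>n. u n / real n) \<longlonglongrightarrow> L" "u 1 \<le> L"
proof
  \<comment> \<open>Index 0 is left out, since its quotient is 0 only through division by
    zero.\<close>
  define L where "L = (SUP n\<in>{1..}. u n / real n)"
  have bdd: "bdd_above ((\<lambda>n. u n / real n) ` {1..})"
    using bound by (intro bdd_aboveI[of _ C]) (auto simp: divide_le_eq mult.commute)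
  have le_L: "u n / real n \<le> L" if "n \<ge> 1" for n
    unfolding L_def by (rule cSUP_upper[OF _ bdd]) (use that in simp)
  show "u 1 \<le> L" using le_L[of 1] by simp
  have mult: "real k * u q \<le> u (k * q)" for k q
  proof (induction k)
    case 0
    show ?case using nonneg[of 0] by simp
  next
    case (Suc k)
    thus ?case using super[of q "k * q"] by (simp add: algebra_simps)
  qed
  show "(\<lambda>n. u n / real n) \<longlonglongrightarrow> L"
  proof (rule order_tendstoI)
    fix c assume "L < c"
    show "eventually (\<lambda>n. u n / real n < c) sequentially"
      using eventually_ge_at_top[of 1] by eventually_elim (use le_L \<open>L < c\<close> in force)
  next
    fix c assume "c < L"
    \<comment> \<open>Fix \<open>q\<close> whose quotient exceeds \<open>c\<close>; the loss from
      rounding \<open>n\<close> down to a multiple of \<open>q\<close> is at most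
      \<open>u q / n\<close>, which tends to 0.\<close>
    then obtain q where q: "q \<ge> 1" "c < u q / real q"
      unfolding L_def using less_cSUP_iff[OF _ bdd] by auto
    have "(\<lambda>n. u q / real q - u q / real n) \<longlonglongrightarrow> u q / real q - 0"
      by (intro tendsto_intros lim_const_over_n)
    hence "eventually (\<lambda>n. c < u q / real q - u q / real n) sequentially"
      using q(2) by (intro order_tendstoD(1)) auto
    thus "eventually (\<lambda>n. c < u n / real n) sequentially"
      using eventually_ge_at_top[of 1]
    proof eventually_elim
      fix n assume n: "c < u q / real q - u q / real n" "n \<ge> 1"
      have "n \<le> (n div q) * q + q"
        using div_mult_mod_eq[of n q] mod_less_divisor[of q n] q by linarith
      hence "real n \<le> (real (n div q) + 1) * real q"
        by (metis (mono_tags, lifting) add.commute mult.commute mult_Suc of_nat_Suc of_nat_le_iff of_nat_mult)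
      hence "real n / real q - 1 \<le> real (n div q)" using q by (simp add: field_simps)
      hence "(real n / real q - 1) * u q \<le> real (n div q) * u q"
        using nonneg by (rule mult_right_mono)
      also have "\<dots> \<le> u (n div q * q)" by (rule mult)
      \<comment> \<open>The remainder contributes a nonnegative amount, so it can be restored to
        reach \<open>u n\<close>.\<close>
      also have "\<dots> \<le> u (n div q * q) + u (n mod q)" using nonneg by simp
      also have "\<dots> \<le> u n" using super[of "n div q * q" "n mod q"] by simp
      finally have "(real n / real q - 1) * u q / real n \<le> u n / real n"
        by (rule divide_right_mono) simp
      moreover have "(real n / real q - 1) * u q / real n = u q / real q - u q / real n"
        using n q by (simp add: field_simps)
      ultimately show "c < u n / real n" using n by simp
    qed
  qed
qed

text \<open>\<open>lim\<close> can be evaluated only after convergence is known, which Fekete's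
  lemma provides. The left side is the first term of the sequence, hence the form with exponent
  1.\<close>

lemma zero_error_capacity_ge_one_shot:
  assumes S: "S \<subseteq> carrier_mat n n" and one: "1\<^sub>m n \<in> S" and n: "n \<ge> 1"
  shows "one_shot_capacity (n ^ 1) (graph_power n S 1) \<le> zero_error_capacity n S"
proof -
  define u where "u k = one_shot_capacity (n ^ k) (graph_power n S k)" for k
  note one_k = one_in_graph_power[OF S one]
  have n_k: "n ^ k \<ge> 1" for k using n by simp
  have super: "u a + u b \<le> u (a + b)" for a b
  proof -
    let ?\<alpha> = "\<lambda>k. indep_number (n ^ k) (graph_power n S k)"
    have ge_1: "?\<alpha> a \<ge> 1" "?\<alpha> b \<ge> 1" using indep_number_ge_1[OF one_k n_k] by auto
    have "independent_size (n ^ (a + b)) (graph_power n S (a + b)) (?\<alpha> a * ?\<alpha> b)"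
      by (intro independent_size_graph_power_add[OF S] independent_size_indep_number one_k)
    hence "log 2 (real (?\<alpha> a * ?\<alpha> b)) \<le> u (a + b)"
      unfolding u_def using ge_1 by (intro one_shot_capacity_ge[OF one_k]) (simp_all add: Suc_le_eq)
    moreover have "log 2 (real (?\<alpha> a * ?\<alpha> b)) = u a + u b"
      using ge_1 by (simp add: u_def one_shot_capacity_def log_mult)
    ultimately show ?thesis by simp
  qed
  have nonneg: "0 \<le> u a" for a unfolding u_def by (rule one_shot_capacity_nonneg[OF one_k n_k])
  have bound: "u a \<le> real a * log 2 (real n)" for a
    using one_shot_capacity_le[OF one_k n_k, of a] n by (simp add: u_def log_nat_power)
  obtain L where "(\<lambda>k. u k / real k) \<longlonglongrightarrow> L" "u 1 \<le> L"
    using fekete_superadditive[OF super nonneg bound] by blast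
  thus ?thesis by (simp add: zero_error_capacity_def u_def limI)
qed

text \<open>No power has an independent pair, by induction on the exponent, so the sequence is
  identically zero.\<close>

lemma zero_error_capacity_shift_graph: "zero_error_capacity (m + 1) (shift_graph m) = 0"
proof -
  have "connected_graph ((m + 1) ^ k) (graph_power (m + 1) (shift_graph m) k)" for k
  proof (induction k)
    case 0
    have "x = 0\<^sub>v 1 \<or> y = 0\<^sub>v 1"
      if "x \<in> carrier_vec 1" "y \<in> carrier_vec 1" "ketbra x y \<in> hs_compl 1 (carrier_mat 1 1)" for x y
    proof -
      have "hs_inner (ketbra x y) (1\<^sub>m 1) = 0" using that by (simp add: hs_compl_def)
      hence "x $ 0 = 0 \<or> y $ 0 = 0" using that by (simp add: hs_inner_ketbra_one)
      thus ?thesis using that by (auto intro!: eq_vecI)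
    qed
    thus ?case by (auto simp: connected_graph_def)
  next
    case (Suc k)
    show ?case
      using connected_shift_tensor[OF Suc.IH graph_power_carrier[OF shift_graph_carrier]] by simp
  qed
  hence "one_shot_capacity ((m + 1) ^ k) (graph_power (m + 1) (shift_graph m) k) = 0" for k
    by (intro one_shot_capacity_connected one_in_graph_power shift_graph_carrier one_in_shift_graph) auto
  thus ?thesis by (simp add: zero_error_capacity_def limI)
qed

section \<open>Capacity of the scalar graph\<close>

lemma scalar_graph_carrier: "scalar_graph n \<subseteq> carrier_mat n n"
  by (auto simp: scalar_graph_def)

lemma one_in_scalar_graph: "1\<^sub>m n \<in> scalar_graph n"
  unfolding scalar_graph_def by (rule range_eqI[of _ _ 1]) auto

text \<open>Tensor powers of scalars are scalars, so the standard basis of the \<open>k\<close>-th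
  power is independent and attains the dimension bound.\<close>

lemma zero_error_capacity_scalar_graph:
  assumes "n \<ge> 1"
  shows "zero_error_capacity n (scalar_graph n) = log 2 (real n)"
proof -
  note one_k = one_in_graph_power[OF scalar_graph_carrier one_in_scalar_graph]
  have scalar: "elementary_tensors n (scalar_graph n) k \<subseteq> scalar_graph (n ^ k)" for k
  proof (induction k)
    case 0
    show ?case using one_in_scalar_graph[of 1] by simp
  next
    case (Suc k)
    show ?case
    proof
      fix R assume "R \<in> elementary_tensors n (scalar_graph n) (Suc k)"
      then obtain c d where "R = kron (c \<cdot>\<^sub>m 1\<^sub>m n) (d \<cdot>\<^sub>m 1\<^sub>m (n ^ k))"
        using Suc.IH unfolding scalar_graph_def by auto
      thus "R \<in> scalar_graph (n ^ Suc k)" by (simp add: kron_smult kron_one_one scalar_graph_def)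
    qed
  qed
  have "independent_size (n ^ k) (graph_power n (scalar_graph n) k) (n ^ k)" for k
  proof -
    have "hs_inner (ketbra (unit_vec (n ^ k) s) (unit_vec (n ^ k) t)) R = 0"
      if "s < n ^ k" "t < n ^ k" "s \<noteq> t" "R \<in> scalar_graph (n ^ k)" for s t R
    proof -
      obtain c where R: "R = c \<cdot>\<^sub>m 1\<^sub>m (n ^ k)" using \<open>R \<in> _\<close> by (auto simp: scalar_graph_def)
      have "hs_inner (ketbra (unit_vec (n ^ k) s) (unit_vec (n ^ k) t)) (1\<^sub>m (n ^ k)) = 0"
        unfolding hs_inner_ketbra_one[OF unit_vec_carrier unit_vec_carrier]
        using that by (intro sum.neutral) auto
      thus ?thesis
        by (simp add: R hs_inner_smult_right[OF ketbra_carrier[OF unit_vec_carrier unit_vec_carrier] one_carrier_mat])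
    qed
    hence "ketbra (unit_vec (n ^ k) s) (unit_vec (n ^ k) t) \<in> hs_compl (n ^ k) (graph_power n (scalar_graph n) k)"
      if "s < n ^ k" "t < n ^ k" "s \<noteq> t" for s t
      unfolding hs_compl_graph_power[OF scalar_graph_carrier] using that scalar[of k]
      by (auto simp: hs_compl_def ketbra_carrier)
    thus ?thesis unfolding independent_size_def by (intro exI[of _ "unit_vec (n ^ k)"]) auto
  qed
  hence "one_shot_capacity (n ^ k) (graph_power n (scalar_graph n) k) = log 2 (real (n ^ k))" for k
    using assms by (intro antisym one_shot_capacity_le[OF one_k] one_shot_capacity_ge[OF one_k]) auto
  hence "one_shot_capacity (n ^ k) (graph_power n (scalar_graph n) k) = real k * log 2 (real n)" for k
    using assms by (simp add: log_nat_power)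
  \<comment> \<open>The sequence is constant only from \<open>k = 1\<close> on; at
    \<open>k = 0\<close> it takes the value 0.\<close>
  moreover have "(\<lambda>k. 1 / real k * (real k * log 2 (real n))) \<longlonglongrightarrow> log 2 (real n)"
    by (rule tendsto_eventually) (use eventually_ge_at_top[of 1] in \<open>eventually_elim, simp\<close>)
  ultimately show ?thesis by (simp add: zero_error_capacity_def limI)
qed

text \<open>The vectors \<open>|0\<rangle>|s\<rangle> + |1\<rangle>|s + 1\<rangle>\<close>: tracing out the qubit from their cross terms leaves the
  operators \<open>shift_pair m s t\<close>.\<close>

lemma independent_size_scalar_tensor_shift:
  "independent_size (2 * (m + 1)) (graph_tensor 2 (scalar_graph 2) (m + 1) (shift_graph m)) m"
proof -
  define \<psi> where "\<psi> s = vec (2 * (m + 1)) (\<lambda>i. of_bool (i = s \<or> i = (m + 1) + (s + 1)) :: complex)" for s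
  have c: "\<psi> s \<in> carrier_vec (2 * (m + 1))" for s by (simp add: \<psi>_def)
  \<comment> \<open>In block \<open>a\<close> of the qubit the only nonzero entry sits at
    \<open>s + a\<close>.\<close>
  have idx: "\<psi> s $ (a * (m + 1) + r) = of_bool (r = s + a)" if "s < m" "a < 2" "r < m + 1" for s a r
    using that by (auto simp: \<psi>_def less_2_cases_iff)
  have "\<psi> s \<noteq> 0\<^sub>v (2 * (m + 1))" if "s < m" for s
  proof
    assume "\<psi> s = 0\<^sub>v (2 * (m + 1))"
    hence "\<psi> s $ s = 0" using that by simp
    thus False using that by (simp add: \<psi>_def)
  qed
  moreover have "hs_inner (ketbra (\<psi> s) (\<psi> t)) (kron (z \<cdot>\<^sub>m 1\<^sub>m 2) Q) = 0"
    if st: "s < m" "t < m" "s \<noteq> t" and Q: "Q \<in> shift_graph m" for s t z Q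
  proof -
    have Qc: "Q \<in> carrier_mat (m + 1) (m + 1)" using Q shift_graph_carrier by blast
    have zc: "z \<cdot>\<^sub>m 1\<^sub>m 2 \<in> carrier_mat 2 2" by simp
    have "hs_inner (ketbra (\<psi> s) (\<psi> t)) (kron (z \<cdot>\<^sub>m 1\<^sub>m 2) Q) =
        (\<Sum>a<2. \<Sum>b<2. \<Sum>r<m + 1. \<Sum>r'<m + 1.
          if r = s + a then if r' = t + b then (z \<cdot>\<^sub>m 1\<^sub>m 2) $$ (a, b) * Q $$ (r, r') else 0 else 0)"
      unfolding hs_inner_kron[OF ketbra_carrier[OF c c] zc Qc]
    proof (intro sum.cong refl)
      fix a b r r' assume *: "a \<in> {..<2::nat}" "b \<in> {..<2::nat}" "r \<in> {..<m + 1}" "r' \<in> {..<m + 1}"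
      have "ketbra (\<psi> s) (\<psi> t) $$ (a * (m + 1) + r, b * (m + 1) + r') =
          of_bool (r = s + a) * of_bool (r' = t + b)"
        using * st idx c[of s] c[of t] mult_add_less[of a 2 r "m + 1"] mult_add_less[of b 2 r' "m + 1"]
        by (simp add: ketbra_def del: mult_Suc_right)
      thus "cnj (ketbra (\<psi> s) (\<psi> t) $$ (a * (m + 1) + r, b * (m + 1) + r')) * (z \<cdot>\<^sub>m 1\<^sub>m 2) $$ (a, b) * Q $$ (r, r') =
          (if r = s + a then if r' = t + b then (z \<cdot>\<^sub>m 1\<^sub>m 2) $$ (a, b) * Q $$ (r, r') else 0 else 0)"
        by simp
    qed
    also have "\<dots> = (\<Sum>a<2. \<Sum>b<2. (z \<cdot>\<^sub>m 1\<^sub>m 2) $$ (a, b) * Q $$ (s + a, t + b))"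
    proof (intro sum.cong refl)
      fix a b assume "a \<in> {..<2::nat}" "b \<in> {..<2::nat}"
      hence "s + a < m + 1" "t + b < m + 1" using st by auto
      thus "(\<Sum>r<m + 1. \<Sum>r'<m + 1.
          if r = s + a then if r' = t + b then (z \<cdot>\<^sub>m 1\<^sub>m 2) $$ (a, b) * Q $$ (r, r') else 0 else 0) =
          (z \<cdot>\<^sub>m 1\<^sub>m 2) $$ (a, b) * Q $$ (s + a, t + b)"
        by (subst sum.swap) simp
    qed
    \<comment> \<open>The scalar on the qubit kills the terms with \<open>a \<noteq> b\<close>; the
      two that remain form a defining equation of the shift graph.\<close>
    also have "\<dots> = z * (Q $$ (s, t) + Q $$ (s + 1, t + 1))"
      by (simp add: numeral_2_eq_2 algebra_simps)
    also have "\<dots> = 0" using Q st by (simp add: shift_graph_eq)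
    finally show ?thesis .
  qed
  hence "ketbra (\<psi> s) (\<psi> t) \<in> hs_compl (2 * (m + 1)) (graph_tensor 2 (scalar_graph 2) (m + 1) (shift_graph m))"
    if "s < m" "t < m" "s \<noteq> t" for s t
    unfolding hs_compl_graph_tensor[OF scalar_graph_carrier shift_graph_carrier]
    using that ketbra_carrier[OF c c] by (auto simp: scalar_graph_def)
  ultimately show ?thesis unfolding independent_size_def using c by blast
qed

lemma kron_one_right: "kron P (1\<^sub>m 1) = P"
  by (rule eq_matI) (simp_all add: kron_def)

text \<open>The first power carries an extra one-dimensional factor. Only complements are compared,
  and the elementary tensors of degree 1 are \<open>S\<close> itself.\<close>

lemma independent_size_graph_power_1:
  assumes S: "S \<subseteq> carrier_mat n n" and "independent_size n S k"
  shows "independent_size (n ^ 1) (graph_power n S 1) k"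
proof -
  have "elementary_tensors n S 1 = S"
    using kron_one_right by auto
  hence "hs_compl (n ^ 1) (graph_power n S 1) = hs_compl n S"
    using hs_compl_graph_power[OF S, of 1] by simp
  thus ?thesis using assms(2) by (simp add: independent_size_def)
qed

theorem theorem15:
  fixes m :: nat
  assumes "m \<ge> 3"
  shows "noncommutative_graph (m + 1) (shift_graph m) \<and>
    one_shot_capacity (m + 1) (shift_graph m) = 0 \<and>
    (\<forall>d S. d \<ge> 1 \<longrightarrow> noncommutative_graph d S \<longrightarrow> one_shot_capacity d S = 0 \<longrightarrow>
       one_shot_capacity (d * (m + 1)) (graph_tensor d S (m + 1) (shift_graph m)) = 0) \<and>
    zero_error_capacity (m + 1) (shift_graph m) = 0 \<and>
    zero_error_capacity (2 * (m + 1)) (graph_tensor 2 (scalar_graph 2) (m + 1) (shift_graph m))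
      \<ge> log 2 (real m) \<and>
    log 2 (real m) > 1 \<and>
    1 = zero_error_capacity 2 (scalar_graph 2) + zero_error_capacity (m + 1) (shift_graph m)"
proof (intro conjI allI impI)
  show "noncommutative_graph (m + 1) (shift_graph m)"
    by (rule noncommutative_graph_shift_graph)
  show "zero_error_capacity (m + 1) (shift_graph m) = 0"
    by (rule zero_error_capacity_shift_graph)
  thus "1 = zero_error_capacity 2 (scalar_graph 2) + zero_error_capacity (m + 1) (shift_graph m)"
    by (simp add: zero_error_capacity_scalar_graph)
  show "log 2 (real m) > 1" using assms by (simp add: less_log_iff)
  show "one_shot_capacity (m + 1) (shift_graph m) = 0"
  proof (rule antisym)
    have S: "shift_graph m \<subseteq> carrier_mat (m + 1) (m + 1)" "1\<^sub>m (m + 1) \<in> shift_graph m"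
      by (rule shift_graph_carrier one_in_shift_graph)+
    \<comment> \<open>The one-shot capacity is squeezed between 0 and the asymptotic capacity,
      already known to vanish.\<close>
    have "one_shot_capacity (m + 1) (shift_graph m) \<le>
        one_shot_capacity ((m + 1) ^ 1) (graph_power (m + 1) (shift_graph m) 1)"
      unfolding one_shot_capacity_def[of "m + 1" "shift_graph m"]
      by (intro one_shot_capacity_ge one_in_graph_power[OF S] independent_size_graph_power_1[OF S(1)]
          independent_size_indep_number[OF S(2)] indep_number_ge_1[OF S(2)]) simp
    also have "\<dots> \<le> zero_error_capacity (m + 1) (shift_graph m)"
      by (rule zero_error_capacity_ge_one_shot[OF S]) simp
    also have "\<dots> = 0" by (rule zero_error_capacity_shift_graph)
    finally show "one_shot_capacity (m + 1) (shift_graph m) \<le> 0" .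
    show "0 \<le> one_shot_capacity (m + 1) (shift_graph m)"
      by (rule one_shot_capacity_nonneg[OF S(2)]) simp
  qed
next
  let ?G = "graph_tensor 2 (scalar_graph 2) (m + 1) (shift_graph m)"
  have G: "?G \<subseteq> carrier_mat (2 * (m + 1)) (2 * (m + 1))"
    by (rule graph_tensor_carrier[OF scalar_graph_carrier shift_graph_carrier])
  have one: "1\<^sub>m (2 * (m + 1)) \<in> ?G"
    by (rule one_in_graph_tensor[OF scalar_graph_carrier shift_graph_carrier
        one_in_scalar_graph one_in_shift_graph])
  \<comment> \<open>The \<open>m\<close> independent vectors of the one-shot construction are
    transferred to the first power.\<close>
  have "log 2 (real m) \<le> one_shot_capacity ((2 * (m + 1)) ^ 1) (graph_power (2 * (m + 1)) ?G 1)"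
    using assms by (intro one_shot_capacity_ge one_in_graph_power[OF G one]
        independent_size_graph_power_1[OF G] independent_size_scalar_tensor_shift) simp
  also have "\<dots> \<le> zero_error_capacity (2 * (m + 1)) ?G"
    by (rule zero_error_capacity_ge_one_shot[OF G one]) simp
  finally show "log 2 (real m) \<le> zero_error_capacity (2 * (m + 1)) ?G" .
next
  fix d :: nat and S
  assume d: "d \<ge> 1" and S: "noncommutative_graph d S" and "one_shot_capacity d S = 0"
  have one: "1\<^sub>m d \<in> S" and "submodule class_ring S (op_space d)"
    using S by (auto simp: noncommutative_graph_def VectorSpace.subspace_def)
  hence Sc: "S \<subseteq> carrier_mat d d"
    by (auto simp: LinearCombinations.submodule_def module_mat_simps)
  show "one_shot_capacity (d * (m + 1)) (graph_tensor d S (m + 1) (shift_graph m)) = 0"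
  proof (rule one_shot_capacity_connected)
    show "1\<^sub>m (d * (m + 1)) \<in> graph_tensor d S (m + 1) (shift_graph m)"
      by (rule one_in_graph_tensor[OF Sc shift_graph_carrier one one_in_shift_graph])
    show "connected_graph (d * (m + 1)) (graph_tensor d S (m + 1) (shift_graph m))"
      using connected_graphI[OF S d] \<open>one_shot_capacity d S = 0\<close> by (intro connected_tensor_shift Sc)
  qed (use d in simp)
qed

end
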